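(* Let $G$ be a unicyclic graph with $\chi_{NL}(G)=k\ge 3$. Then $n(G)\le 2a_1(k)+a_2(k)=\frac12(k^3+k^2-2k)$, where $a_1(k)=k(k-1)$ and $a_2(k)=\frac{k(k-1)(k-2)}{2}$. Moreover, if equality holds, then $G$ has maximum degree $3$ and contains exactly $k(k-1)$ leaves, $\frac{k(k-1)(k-2)}{2}$ vertices of degree $2$, and $k(k-1)$ vertices of degree $3$.
   Context: All graphs are finite, simple, undirected and connected; $n(G)$ is the number of vertices. A unicyclic graph is a connected graph containing exactly one cycle. A $k$-coloring of a graph $G$ is a partition of $V(G)$ into $k$ independent sets (colors). A coloring $\{S_1,\dots,S_k\}$ is neighbor-locating (an NL-coloring) if for any two distinct vertices $u,v$ in the same color class, $\{j: N(u)\cap S_j\neq\emptyset\}\neq\{j: N(v)\cap S_j\neq\emptyset\}$. The neighbor-locating chromatic number $\chi_{NL}(G)$ is the minimum number of colors in an NL-coloring of $G$. *)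

theory Defs
  imports
    Complex_Main
    "HOL-Library.Disjoint_Sets"
    "Graph_Theory.Pair_Digraph"
    "Graph_Theory.Digraph_Component"
begin

text \<open>
  Finite simple undirected graphs are the library's pair graphs: finite, loop-free,
  symmetric arc relations, every undirected edge being represented by its two opposite arcs.
  In such a graph the degree of a vertex is its out-degree.
\<close>

text \<open>
  A directed cycle of the symmetric digraph may be a back-and-forth walk along one edge, hence
  the length condition. Its set of undirected edges abstracts from starting point and
  orientation, so that each cycle of the undirected graph is counted once.
\<close>

definition undirected_cycles :: "'a pair_pre_digraph \<Rightarrow> 'a set set set" where
  "undirected_cycles G =
     {(\<lambda>e. {fst e, snd e}) ` set p | p. pre_digraph.cycle (with_proj G) p \<and> 3 \<le> length p}"

definition unicyclic :: "'a pair_pre_digraph \<Rightarrow> bool" where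
  "unicyclic G \<longleftrightarrow>
     pair_graph G \<and> Digraph_Component.connected (with_proj G) \<and>
     (\<exists>!C. C \<in> undirected_cycles G)"

definition neighborhood :: "'a pair_pre_digraph \<Rightarrow> 'a \<Rightarrow> 'a set" where
  "neighborhood G u = {v. u \<rightarrow>\<^bsub>with_proj G\<^esub> v}"

definition independent_set :: "'a pair_pre_digraph \<Rightarrow> 'a set \<Rightarrow> bool" where
  "independent_set G S \<longleftrightarrow> S \<subseteq> pverts G \<and> (\<forall>u\<in>S. \<forall>v\<in>S. \<not> u \<rightarrow>\<^bsub>with_proj G\<^esub> v)"

definition coloring :: "'a pair_pre_digraph \<Rightarrow> nat \<Rightarrow> 'a set set \<Rightarrow> bool" where
  "coloring G k P \<longleftrightarrow>
     partition_on (pverts G) P \<and> card P = k \<and> (\<forall>S\<in>P. independent_set G S)"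

text \<open>
  The classes of a partition are pairwise distinct, so the set of indices of the color classes
  meeting a neighborhood is rendered as the set of these classes.
\<close>

definition nl_coloring :: "'a pair_pre_digraph \<Rightarrow> nat \<Rightarrow> 'a set set \<Rightarrow> bool" where
  "nl_coloring G k P \<longleftrightarrow>
     coloring G k P \<and>
     (\<forall>S\<in>P. \<forall>u\<in>S. \<forall>v\<in>S. u \<noteq> v \<longrightarrow>
        {T \<in> P. neighborhood G u \<inter> T \<noteq> {}} \<noteq> {T \<in> P. neighborhood G v \<inter> T \<noteq> {}})"

definition nl_chromatic_number :: "'a pair_pre_digraph \<Rightarrow> nat" where
  "nl_chromatic_number G = (LEAST k. \<exists>P. nl_coloring G k P)"

text \<open>The minimum is attained: the partition into singletons is always an NL-coloring.\<close>

lemma ex_nl_coloring: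
  assumes "pair_graph G"
  shows "\<exists>k P. nl_coloring G k P"
proof -
  interpret pair_graph G by fact
  let ?P = "(\<lambda>v. {v}) ` pverts G"
  have "partition_on (pverts G) ?P"
    by (auto simp: partition_on_def disjoint_def)
  then have "nl_coloring G (card ?P) ?P"
    using pair_no_loops by (fastforce simp: nl_coloring_def coloring_def independent_set_def)
  then show ?thesis by blast
qed

lemma nl_coloring_nl_chromatic_number:
  assumes "pair_graph G"
  shows "\<exists>P. nl_coloring G (nl_chromatic_number G) P"
  unfolding nl_chromatic_number_def using ex_nl_coloring[OF assms] by (rule LeastI_ex)

definition max_degree :: "'a pair_pre_digraph \<Rightarrow> nat" where
  "max_degree G = Max (out_degree (with_proj G) ` pverts G)"

definition verts_of_degree :: "'a pair_pre_digraph \<Rightarrow> nat \<Rightarrow> 'a set" where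
  "verts_of_degree G d = {v \<in> pverts G. out_degree (with_proj G) v = d}"

definition a1 :: "nat \<Rightarrow> real" where
  "a1 k = real k * (real k - 1)"

definition a2 :: "nat \<Rightarrow> real" where
  "a2 k = real k * (real k - 1) * (real k - 2) / 2"

end

theory Submission
  imports Defs
begin

text \<open>
  A unicyclic graph has at most as many edges as vertices: deleting an edge of the cycle leaves a
  forest. So its degrees sum to at most twice the number of vertices, and the vertices of degree
  at least 3 are no more numerous than the leaves. In an NL-coloring a vertex is determined
  by its color together with the set of colors seen on its neighborhood. For a leaf this set is a
  single other color, and for a vertex of degree at most 2 it consists of one or two other colors;
  hence there are at most \<open>a1 k\<close> leaves and at most \<open>a1 k + a2 k\<close> vertices of
  degree at most 2.
\<close>

section \<open>Cycles in symmetric relations\<close>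

text \<open>Longest path argument: the first vertex of a longest path has a neighbor other than its
  successor on the path. By maximality this neighbor lies on the path, and it closes a cycle.
  \<open>2 \<le> length xs\<close> means at least three vertices, which excludes running back and
  forth along an edge.\<close>

lemma min_degree_two_imp_cycle:
  fixes R :: "'a rel"
  assumes fin: "finite V" and R: "R \<subseteq> V \<times> V" and "sym R" and "irrefl R" and "V \<noteq> {}"
    and deg: "\<And>v. v \<in> V \<Longrightarrow> 2 \<le> card (R `` {v})"
  obtains x xs where "distinct (x # xs)" "2 \<le> length xs"
    "successively (\<lambda>a b. (a, b) \<in> R) (x # xs @ [x])"
proof -
  define P where "P ws \<longleftrightarrow> ws \<noteq> [] \<and> distinct ws \<and> set ws \<subseteq> V \<and>
    successively (\<lambda>a b. (a, b) \<in> R) ws" for ws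
  obtain v0 where "v0 \<in> V" using \<open>V \<noteq> {}\<close> by blast
  then have "P [v0]" by (simp add: P_def)
  moreover have "\<forall>ws. P ws \<longrightarrow> length ws \<le> card V"
    unfolding P_def by (metis card_mono distinct_card fin)
  ultimately obtain ws where ws: "P ws" and max: "\<And>ws'. P ws' \<Longrightarrow> length ws' \<le> length ws"
    using ex_has_greatest_nat[of P "[v0]" length "Suc (card V)"] by (auto simp: less_Suc_eq_le)
  then obtain x ys where x: "ws = x # ys" unfolding P_def by (cases ws) auto
  have "x \<in> V" using ws x by (simp add: P_def)
  \<comment> \<open>The case expression is the set of successors of \<open>x\<close> on the path,
    empty if the path is the single vertex \<open>x\<close>.\<close>
  have "\<not> R `` {x} \<subseteq> (case ys of [] \<Rightarrow> {} | y # _ \<Rightarrow> {y})"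
  proof
    assume "R `` {x} \<subseteq> (case ys of [] \<Rightarrow> {} | y # _ \<Rightarrow> {y})"
    then have "card (R `` {x}) \<le> 1"
      by (cases ys) (auto dest: card_mono[rotated])
    then show False using deg[OF \<open>x \<in> V\<close>] by simp
  qed
  then obtain z where z: "(x, z) \<in> R" and zhd: "ys \<noteq> [] \<Longrightarrow> z \<noteq> hd ys"
    by (cases ys) auto
  have zx: "(z, x) \<in> R" using z \<open>sym R\<close> by (meson symD)
  have "z \<noteq> x" using z \<open>irrefl R\<close> by (auto simp: irrefl_def)
  have "z \<in> set ws"
  proof (rule ccontr)
    assume "z \<notin> set ws"
    then have "P (z # ws)" using ws x zx R by (auto simp: P_def)
    then show False using max[of "z # ws"] by simp
  qed
  then obtain as bs where ys: "ys = as @ z # bs"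
    using x \<open>z \<noteq> x\<close> by (auto dest: split_list)
  \<comment> \<open>Since \<open>z\<close> is not the successor of \<open>x\<close>, some vertex
    lies between them. The cycle is the path cut off after \<open>z\<close> and closed by the arc
    from \<open>z\<close> to \<open>x\<close>.\<close>
  then have "as \<noteq> []" using zhd by auto
  show ?thesis
  proof (rule that)
    show "distinct (x # as @ [z])" using ws x ys by (auto simp: P_def)
    show "2 \<le> length (as @ [z])" using \<open>as \<noteq> []\<close> by (cases as) auto
    have "successively (\<lambda>a b. (a, b) \<in> R) ((x # as @ [z]) @ bs)"
      using ws x ys by (simp add: P_def)
    then have "successively (\<lambda>a b. (a, b) \<in> R) (x # as @ [z])"
      unfolding successively_append_iff by blast
    then show "successively (\<lambda>a b. (a, b) \<in> R) (x # (as @ [z]) @ [x])"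
      using zx successively_append_iff[of _ "x # as @ [z]" "[x]"] by simp
  qed
qed

text \<open>Removing a vertex of degree at most 1 costs one vertex and at most two arcs, so the
  inequality survives until every degree is at least 2. As each edge counts as two arcs, the
  hypothesis amounts to at least as many edges as vertices; the slack of 1 spares a parity argument
  where the lemma is applied.\<close>

lemma many_arcs_imp_cycle:
  fixes R :: "'a rel"
  assumes "finite V" and "R \<subseteq> V \<times> V" and "sym R" and "irrefl R" and "V \<noteq> {}"
    and "2 * card V \<le> card R + 1"
  shows "\<exists>x xs. distinct (x # xs) \<and> 2 \<le> length xs \<and>
    successively (\<lambda>a b. (a, b) \<in> R) (x # xs @ [x])"
  using assms
proof (induction "card V" arbitrary: V R rule: less_induct)
  case less
  note fin = \<open>finite V\<close> and R = \<open>R \<subseteq> V \<times> V\<close>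
  show ?case
  proof (cases "\<exists>v\<in>V. card (R `` {v}) < 2")
    case False
    then show ?thesis
      using min_degree_two_imp_cycle[OF less.prems(1-5)] by (metis not_less)
  next
    case True
    then obtain v where v: "v \<in> V" "card (R `` {v}) \<le> 1" by force
    define V' where "V' = V - {v}"
    define R' where "R' = R \<inter> V' \<times> V'"
    have finR: "finite R" using fin R by (meson finite_SigmaI finite_subset)
    have finN: "finite (R `` {v})" using fin R finite_subset[of "R `` {v}" V] by blast
    have "R - R' \<subseteq> {v} \<times> (R `` {v}) \<union> (R `` {v}) \<times> {v}"
      using R \<open>sym R\<close> by (auto simp: R'_def V'_def dest: symD)
    then have "card (R - R') \<le> card ({v} \<times> (R `` {v}) \<union> (R `` {v}) \<times> {v})"
      by (rule card_mono[rotated]) (use finN in auto)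
    also have "\<dots> \<le> card ({v} \<times> (R `` {v})) + card ((R `` {v}) \<times> {v})"
      by (rule card_Un_le)
    also have "\<dots> \<le> 2" using v by (simp add: card_cartesian_product)
    finally have "card R \<le> card R' + 2"
      using card_Diff_subset[of R' R] finR finite_subset[of R' R] by (auto simp: R'_def)
    moreover have cV: "card V = card V' + 1"
      unfolding V'_def using v fin card_gt_0_iff[of V] by (subst card_Diff_singleton) auto
    ultimately have c: "2 * card V' \<le> card R' + 1"
      using less.prems(6) by linarith
    \<comment> \<open>A single vertex carries no arc by irreflexivity, and then the inequality would
      read 2 \<le> 1.\<close>
    have "V' \<noteq> {}"
    proof
      assume "V' = {}"
      then have "R \<subseteq> {(v, v)}" using R by (auto simp: V'_def)
      then have "R = {}" using \<open>irrefl R\<close> by (auto simp: irrefl_def)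
      then show False using less.prems(6) cV by simp
    qed
    moreover have "sym R'" "irrefl R'" "R' \<subseteq> V' \<times> V'" "finite V'"
      using \<open>sym R\<close> \<open>irrefl R\<close> fin by (auto simp: R'_def V'_def sym_def irrefl_def)
    ultimately obtain x xs where xs: "distinct (x # xs)" "2 \<le> length xs"
      "successively (\<lambda>a b. (a, b) \<in> R') (x # xs @ [x])"
      using less.hyps[of V' R'] cV c by auto
    from xs(3) have "successively (\<lambda>a b. (a, b) \<in> R) (x # xs @ [x])"
      by (rule successively_mono) (simp add: R'_def)
    then show ?thesis using xs(1,2) by blast
  qed
qed

section \<open>Unicyclic graphs\<close>

text \<open>Zipping a vertex list with its tail gives the arc list of the walk through these
  vertices, the form in which cycles of digraphs are given.\<close>

lemma pcas_zip:
  "pcas x (zip (x # xs) xs) (last (x # xs))"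
  "pawalk_verts x (zip (x # xs) xs) = x # xs"
  by (induction xs arbitrary: x) auto

lemma set_zip_successively:
  "successively (\<lambda>a b. (a, b) \<in> R) (x # xs) \<Longrightarrow> set (zip (x # xs) xs) \<subseteq> R"
proof (induction xs arbitrary: x)
  case (Cons y ys)
  then show ?case using Cons.IH[of y] by auto
qed simp

text \<open>Translates closed vertex lists into members of \<open>undirected_cycles\<close>.
  Recording that the arcs stay in \<open>R\<close> later shows that the cycle avoids a deleted
  edge.\<close>

lemma undirected_cycle_of_list:
  fixes G :: "'a pair_pre_digraph"
  assumes "pair_graph G" and "R \<subseteq> parcs G"
    and "distinct (x # xs)" "2 \<le> length xs" "successively (\<lambda>a b. (a, b) \<in> R) (x # xs @ [x])"
  obtains p where "set p \<subseteq> R" "(\<lambda>e. {fst e, snd e}) ` set p \<in> undirected_cycles G"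
proof -
  interpret pair_graph G by fact
  define p where "p = zip (x # xs @ [x]) (xs @ [x])"
  have len: "length p = length xs + 1" by (simp add: p_def)
  have sub: "set p \<subseteq> R"
    unfolding p_def using assms(5) by (rule set_zip_successively)
  have "x \<in> pverts G"
  proof -
    have "(x, hd xs) \<in> R" using assms(4,5) by (cases xs) auto
    then show ?thesis using assms(2) by (auto dest: in_arcsD1)
  qed
  moreover have "pcas x p x" using pcas_zip(1)[of x "xs @ [x]"] by (simp add: p_def)
  moreover have "pawalk_verts x p = x # xs @ [x]"
    using pcas_zip(2)[of x "xs @ [x]"] by (simp only: p_def)
  ultimately have "cycle p"
    using sub assms(2,3) len unfolding cycle_def awalk_def by (intro exI[of _ x]) auto
  then have "(\<lambda>e. {fst e, snd e}) ` set p \<in> undirected_cycles G"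
    using len assms(4) by (auto simp: undirected_cycles_def)
  with sub show ?thesis by (rule that)
qed

text \<open>With more than 2n arcs on n vertices, deleting both arcs of an edge of the unique cycle
  leaves at least 2n - 1 arcs. These still contain a cycle, which misses the deleted edge and so
  contradicts uniqueness.\<close>

lemma unicyclic_card_parcs:
  fixes G :: "'a pair_pre_digraph"
  assumes "unicyclic G"
  shows "card (parcs G) \<le> 2 * card (pverts G)"
proof (rule ccontr)
  assume many: "\<not> card (parcs G) \<le> 2 * card (pverts G)"
  have pg: "pair_graph G" and uniq: "\<exists>!C. C \<in> undirected_cycles G"
    using assms by (auto simp: unicyclic_def)
  interpret pair_graph G by fact
  obtain C where C: "C \<in> undirected_cycles G" using uniq by blast
  then obtain p where p: "cycle p" "3 \<le> length p" "C = (\<lambda>e. {fst e, snd e}) ` set p"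
    by (auto simp: undirected_cycles_def)
  then obtain u v where uv: "(u, v) \<in> set p" by (cases p) auto
  then have uvG: "(u, v) \<in> parcs G" using p(1) by (auto simp: cycle_def awalk_def)
  have sym: "sym (parcs G)" using pair_sym_arcs by (simp add: symmetric_def)
  define R where "R = parcs G - {(u, v), (v, u)}"
  have "card (parcs G) \<le> card R + 2"
  proof -
    have "card (parcs G) - card {(u, v), (v, u)} \<le> card R"
      unfolding R_def by (rule diff_card_le_card_Diff) simp
    moreover have "card {(u, v), (v, u)} \<le> 2" by (cases "u = v") simp_all
    ultimately show ?thesis by linarith
  qed
  then have "2 * card (pverts G) \<le> card R + 1" using many by linarith
  moreover have "pverts G \<noteq> {}" using uvG in_arcsD1 by blast
  moreover have "R \<subseteq> pverts G \<times> pverts G" by (auto simp: R_def dest: wellformed')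
  moreover have "Relation.sym R" using sym by (auto simp: R_def sym_def)
  moreover have "irrefl R" using pair_no_loops by (fastforce simp: R_def irrefl_def)
  ultimately obtain x xs where xs: "distinct (x # xs)" "2 \<le> length xs"
    "successively (\<lambda>a b. (a, b) \<in> R) (x # xs @ [x])"
    using many_arcs_imp_cycle[of "pverts G" R] pair_finite_verts by blast
  then obtain q where q: "set q \<subseteq> R" "(\<lambda>e. {fst e, snd e}) ` set q \<in> undirected_cycles G"
    using undirected_cycle_of_list[OF pg, of R x xs] by (auto simp: R_def)
  then have "(\<lambda>e. {fst e, snd e}) ` set q = C" using uniq C by blast
  moreover have "{u, v} \<in> C" using uv p(3) by force
  ultimately obtain e where "e \<in> set q" "{u, v} = {fst e, snd e}" by auto
  then show False using q(1) by (cases e) (auto simp: R_def doubleton_eq_iff)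
qed

section \<open>Degrees in symmetric digraphs\<close>

lemma connected_out_degree_pos:
  fixes G :: "'a pair_pre_digraph"
  assumes "pair_graph G" and "Digraph_Component.connected (with_proj G)"
    and "2 \<le> card (pverts G)" and u: "u \<in> pverts G"
  shows "0 < out_degree (with_proj G) u"
proof -
  interpret pair_graph G by fact
  have "\<not> pverts G \<subseteq> {u}" using assms(3) card_mono[of "{u}" "pverts G"] by auto
  then obtain w where w: "w \<in> pverts G" "w \<noteq> u" by blast
  \<comment> \<open>By symmetry, connectedness yields a directed walk from \<open>u\<close> to
    \<open>w\<close>; its first arc leaves \<open>u\<close>.\<close>
  have "strongly_connected (with_proj G)"
    using pair_sym_arcs assms(2) by (rule symmetric_connected_imp_strongly_connected)
  then have "u \<rightarrow>\<^sup>*\<^bsub>with_proj G\<^esub> w" using u w by (auto simp: strongly_connected_def)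
  then obtain z where "(u, z) \<in> parcs G"
    using w(2) by (cases rule: converse_reachable_cases) auto
  then have "(u, z) \<in> out_arcs (with_proj G) u" by (simp add: out_arcs_def)
  then show ?thesis
    unfolding out_degree_def using finite_out_arcs by (metis card_gt_0_iff empty_iff)
qed

lemma (in pair_graph) sum_out_degree:
  "(\<Sum>v\<in>pverts G. out_degree (with_proj G) v) = card (parcs G)"
proof -
  have "(\<Sum>v\<in>pverts G. sum (\<lambda>_. 1) {e \<in> parcs G. fst e = v}) = sum (\<lambda>_. 1 :: nat) (parcs G)"
    using pair_finite_arcs pair_finite_verts
    by (rule sum.group) (auto dest: arc_fst_in_verts)
  then show ?thesis by (simp add: out_degree_def out_arcs_def)
qed

lemma (in pair_graph) out_degree_eq_card_neighborhood:
  "out_degree (with_proj G) v = card (neighborhood G v)"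
proof -
  have "out_arcs (with_proj G) v = Pair v ` neighborhood G v"
    by (auto simp: out_arcs_def neighborhood_def)
  then show ?thesis by (simp add: out_degree_def card_image inj_on_def)
qed

section \<open>Counting vertices of small degree\<close>

text \<open>\<open>D\<close> collects the possible numbers of colors seen by vertices of
  \<open>U\<close>. Each vertex of \<open>U\<close> is encoded by its own color and the set of
  colors seen, a subset of the k - 1 other colors with size in \<open>D\<close>; the NL condition
  makes this encoding injective.\<close>

lemma nl_coloring_card_le:
  fixes G :: "'a pair_pre_digraph"
  assumes "pair_graph G" and nl: "nl_coloring G k P" and "U \<subseteq> pverts G"
    and "finite D"
    and D: "\<And>u i. u \<in> U \<Longrightarrow> 0 < i \<Longrightarrow> i \<le> out_degree (with_proj G) u \<Longrightarrow> i \<in> D"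
    and pos: "\<And>u. u \<in> U \<Longrightarrow> 0 < out_degree (with_proj G) u"
  shows "card U \<le> k * (\<Sum>d\<in>D. (k - 1) choose d)"
proof -
  interpret pair_graph G by fact
  have part: "partition_on (pverts G) P" and cP: "card P = k"
    and ind: "\<And>S. S \<in> P \<Longrightarrow> independent_set G S"
    using nl by (auto simp: nl_coloring_def coloring_def)
  have finP: "finite P" using part pair_finite_verts by (rule finite_elements[rotated])
  have "\<exists>S. S \<in> P \<and> u \<in> S" if "u \<in> pverts G" for u
    using part that by (auto simp: partition_on_def)
  then obtain c where c: "\<And>u. u \<in> pverts G \<Longrightarrow> c u \<in> P \<and> u \<in> c u" by metis
  define nb where "nb u = {T \<in> P. neighborhood G u \<inter> T \<noteq> {}}" for u
  have nb_distinct: "\<forall>S\<in>P. \<forall>u\<in>S. \<forall>v\<in>S. u \<noteq> v \<longrightarrow> nb u \<noteq> nb v"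
    using nl unfolding nl_coloring_def nb_def by (rule conjunct2)
  have Nsub: "neighborhood G u \<subseteq> pverts G" for u
    by (auto simp: neighborhood_def dest: wellformed')
  have finN: "finite (neighborhood G u)" for u
    using Nsub pair_finite_verts finite_subset by blast
  have cuniq: "T = c w" if "T \<in> P" "w \<in> T" for T w
  proof -
    have "w \<in> pverts G" using part that by (auto simp: partition_on_def)
    then have "c w \<in> P" "w \<in> c w" using c by auto
    then show ?thesis using part that by (auto simp: partition_on_def disjoint_def)
  qed
  \<comment> \<open>As an image of the neighborhood, the set of seen colors is no larger than the
    degree, and it is nonempty if the degree is positive.\<close>
  have nb: "nb u = c ` neighborhood G u" for u
  proof
    show "nb u \<subseteq> c ` neighborhood G u" unfolding nb_def using cuniq by blast
    show "c ` neighborhood G u \<subseteq> nb u" unfolding nb_def using Nsub[of u] c by blast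
  qed
  have card_nb: "card (nb u) \<in> D" if "u \<in> U" for u
  proof -
    have deg: "card (neighborhood G u) = out_degree (with_proj G) u"
      by (simp add: out_degree_eq_card_neighborhood)
    have "card (nb u) \<le> out_degree (with_proj G) u"
      unfolding nb deg[symmetric] by (rule card_image_le[OF finN])
    moreover have "0 < card (nb u)"
      unfolding nb using pos[OF that] finN deg by (auto simp: card_gt_0_iff)
    ultimately show ?thesis using D[OF that] by blast
  qed
  \<comment> \<open>A vertex does not see its own color, because color classes are
    independent.\<close>
  have nb_sub: "nb u \<subseteq> P - {c u}" if "u \<in> pverts G" for u
    using ind[of "c u"] c[OF that] by (auto simp: nb_def independent_set_def neighborhood_def)
  define T where "T = Sigma P (\<lambda>S. \<Union>d\<in>D. {B. B \<subseteq> P - {S} \<and> card B = d})"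
  have "inj_on (\<lambda>u. (c u, nb u)) U"
  proof (rule inj_onI, rule ccontr)
    fix u v assume uv: "u \<in> U" "v \<in> U" "(c u, nb u) = (c v, nb v)" "u \<noteq> v"
    have "c u \<in> P \<and> u \<in> c u \<and> v \<in> c v"
      using c \<open>U \<subseteq> pverts G\<close> uv(1,2) by (simp add: subset_iff)
    then have "c u \<in> P" "u \<in> c u" "v \<in> c u" using uv(3) by auto
    then show False using nb_distinct \<open>u \<noteq> v\<close> uv(3) by blast
  qed
  moreover have "(\<lambda>u. (c u, nb u)) ` U \<subseteq> T"
    using c nb_sub card_nb \<open>U \<subseteq> pverts G\<close> by (auto simp: T_def)
  moreover have "finite T" using finP \<open>finite D\<close> by (auto simp: T_def)
  ultimately have "card U \<le> card T" by (rule card_inj_on_le)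
  also have "card T = (\<Sum>S\<in>P. card (\<Union>d\<in>D. {B. B \<subseteq> P - {S} \<and> card B = d}))"
    unfolding T_def using finP \<open>finite D\<close> by (intro card_SigmaI) auto
  also have "\<dots> = (\<Sum>S\<in>P. \<Sum>d\<in>D. (k - 1) choose d)"
  proof (rule sum.cong)
    fix S assume "S \<in> P"
    have "card (\<Union>d\<in>D. {B. B \<subseteq> P - {S} \<and> card B = d}) =
      (\<Sum>d\<in>D. card {B. B \<subseteq> P - {S} \<and> card B = d})"
      using finP \<open>finite D\<close> by (intro card_UN_disjoint) auto
    then show "card (\<Union>d\<in>D. {B. B \<subseteq> P - {S} \<and> card B = d}) = (\<Sum>d\<in>D. (k - 1) choose d)"
      using finP cP \<open>S \<in> P\<close> by (simp add: n_subsets)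
  qed simp
  finally show ?thesis using cP by simp
qed

text \<open>With A, B, C the elements of value 1, 2 and at least 3, the bound on the sum gives |C|
  \<le> |A|. Hence |V| \<le> (|A| + |B|) + |A| \<le> (a + b) + a, and equality makes each of these
  estimates sharp.\<close>

lemma sparse_degree_count:
  fixes d :: "'a \<Rightarrow> nat"
  assumes fin: "finite V" and pos: "\<forall>v\<in>V. 0 < d v" and sum: "sum d V \<le> 2 * card V"
    and L1: "card {v \<in> V. d v = 1} \<le> a" and L12: "card {v \<in> V. d v \<le> 2} \<le> a + b"
  shows "card V \<le> 2 * a + b"
    and "card V = 2 * a + b \<Longrightarrow> card {v \<in> V. d v = 1} = a \<and> card {v \<in> V. d v = 2} = b \<and>
      card {v \<in> V. d v = 3} = a \<and> (\<forall>v\<in>V. d v \<le> 3)"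
proof -
  define A where "A = {v \<in> V. d v = 1}"
  define B where "B = {v \<in> V. d v = 2}"
  define C where "C = {v \<in> V. 3 \<le> d v}"
  have finABC: "finite A" "finite B" "finite C" using fin by (auto simp: A_def B_def C_def)
  have dis: "A \<inter> B = {}" "(A \<union> B) \<inter> C = {}" by (auto simp: A_def B_def C_def)
  have AB: "A \<union> B = {v \<in> V. d v \<le> 2}"
    using pos by (force simp: A_def B_def)
  have V: "V = (A \<union> B) \<union> C" unfolding AB C_def by auto
  have cAB: "card A + card B \<le> a + b"
    using L12 AB card_Un_disjoint[OF finABC(1,2) dis(1)] by simp
  have cV: "card V = card A + card B + card C"
    using V card_Un_disjoint finABC dis by (metis finite_UnI)
  have "sum d V = sum d A + sum d B + sum d C"
    using V sum.union_disjoint[of "A \<union> B" C d] sum.union_disjoint[of A B d] finABC dis by simp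
  moreover have "sum d A = card A" "sum d B = 2 * card B" by (simp_all add: A_def B_def)
  ultimately have sC: "sum d C \<le> 2 * card C + card A" using sum cV by linarith
  have C3: "3 * card C \<le> sum d C"
    using sum_mono[of C "\<lambda>_. 3" d] by (simp add: C_def)
  have cA: "card A \<le> a" using L1 by (simp add: A_def)
  show "card V \<le> 2 * a + b" using cV cAB cA sC C3 by linarith
  assume eq: "card V = 2 * a + b"
  then have c: "card A = a" "card B = b" "card C = a" "sum d C = 3 * card C"
    using cV cAB cA sC C3 by linarith+
  \<comment> \<open>The values on \<open>C\<close> are at least 3 and their sum is exactly 3|C|, so
    none can exceed 3.\<close>
  have d3: "d v = 3" if "v \<in> C" for v
  proof (rule ccontr)
    assume "d v \<noteq> 3"
    then have "sum (\<lambda>_. 3) C < sum d C"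
      using that finABC(3) by (intro sum_strict_mono_ex1) (auto simp: C_def intro!: bexI[of _ v])
    then show False using c(4) by simp
  qed
  then have "C = {v \<in> V. d v = 3}" by (auto simp: C_def)
  moreover have "\<forall>v\<in>V. d v \<le> 3"
    using d3 by (metis (mono_tags, lifting) C_def linear mem_Collect_eq order_refl)
  ultimately show "card {v \<in> V. d v = 1} = a \<and> card {v \<in> V. d v = 2} = b \<and>
      card {v \<in> V. d v = 3} = a \<and> (\<forall>v\<in>V. d v \<le> 3)"
    using c by (simp add: A_def B_def)
qed

theorem theorem21:
  fixes G :: "'a pair_pre_digraph" and k :: nat
  assumes "unicyclic G"
    and "nl_chromatic_number G = k"
    and "k \<ge> 3"
  shows "real (card (pverts G)) \<le> 2 * a1 k + a2 k \<and>
    2 * a1 k + a2 k = 1 / 2 * (real k ^ 3 + real k ^ 2 - 2 * real k) \<and>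
    (real (card (pverts G)) = 2 * a1 k + a2 k \<longrightarrow>
       max_degree G = 3 \<and>
       real (card (verts_of_degree G 1)) = real k * (real k - 1) \<and>
       real (card (verts_of_degree G 2)) = real k * (real k - 1) * (real k - 2) / 2 \<and>
       real (card (verts_of_degree G 3)) = real k * (real k - 1))"
proof -
  have pg: "pair_graph G" and conn: "Digraph_Component.connected (with_proj G)"
    using assms(1) by (auto simp: unicyclic_def)
  interpret pair_graph G by fact
  obtain P where nl: "nl_coloring G k P"
    using nl_coloring_nl_chromatic_number[OF pg] assms(2) by blast
  define d where "d = out_degree (with_proj G)"
  define a where "a = k * (k - 1)"
  define b where "b = k * ((k - 1) choose 2)"
  \<comment> \<open>Representatives of the k \<ge> 3 color classes show that there is more than one
    vertex, so that connectedness excludes isolated vertices.\<close>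
  have "card P \<le> card (pverts G)"
  proof -
    have part: "partition_on (pverts G) P" using nl by (auto simp: nl_coloring_def coloring_def)
    then have "\<forall>S\<in>P. \<exists>u. u \<in> S" unfolding partition_on_def by (metis ex_in_conv)
    then obtain r where r: "\<And>S. S \<in> P \<Longrightarrow> r S \<in> S" by metis
    have "inj_on r P"
    proof (rule inj_onI)
      fix S T assume "S \<in> P" "T \<in> P" "r S = r T"
      then have "S \<inter> T \<noteq> {}" using r[of S] r[of T] by auto
      then show "S = T"
        using part \<open>S \<in> P\<close> \<open>T \<in> P\<close> unfolding partition_on_def disjoint_def by meson
    qed
    moreover have "r ` P \<subseteq> pverts G" using part r unfolding partition_on_def by blast
    ultimately show ?thesis using pair_finite_verts by (rule card_inj_on_le)
  qed
  then have "2 \<le> card (pverts G)"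
    using nl assms(3) by (auto simp: nl_coloring_def coloring_def)
  then have pos: "\<forall>v\<in>pverts G. 0 < d v"
    unfolding d_def using connected_out_degree_pos[OF pg conn] by blast
  have L1: "card {v \<in> pverts G. d v = 1} \<le> a"
    using nl_coloring_card_le[OF pg nl, of "{v \<in> pverts G. d v = 1}" "{1}"]
    by (auto simp: a_def d_def)
  \<comment> \<open>Leaves are included because a vertex of degree 2 may see only one color and then
    uses up a code that a leaf could have had. The bound is k times the number of sets of one or two
    other colors.\<close>
  have L12: "card {v \<in> pverts G. d v \<le> 2} \<le> a + b"
    using nl_coloring_card_le[OF pg nl, of "{v \<in> pverts G. d v \<le> 2}" "{1, 2}"] pos
    by (force simp: a_def b_def d_def algebra_simps)
  have sum: "sum d (pverts G) \<le> 2 * card (pverts G)"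
    unfolding d_def sum_out_degree using assms(1) by (rule unicyclic_card_parcs)
  note count = sparse_degree_count[OF pair_finite_verts pos sum L1 L12]
  have ra: "real a = a1 k" using assms(3) by (simp add: a_def a1_def)
  have rb: "real b = a2 k"
  proof -
    \<comment> \<open>Writing k as m + 2 removes the truncated subtraction before passing to the
      reals.\<close>
    obtain m where m: "k = Suc (Suc m)"
      using assms(3) by (metis Suc_le_D numeral_3_eq_3 Suc_le_mono)
    have "2 * ((k - 1) choose 2) = Suc m * m" by (simp add: m choose_two)
    then have "2 * real ((k - 1) choose 2) = real (Suc m * m)" by linarith
    then have "2 * real ((k - 1) choose 2) = (real k - 1) * (real k - 2)"
      by (simp add: m algebra_simps)
    then show ?thesis by (simp add: b_def a2_def)
  qed
  have "real (card (pverts G)) \<le> 2 * a1 k + a2 k"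
    using count(1) unfolding ra[symmetric] rb[symmetric] by linarith
  moreover have "2 * a1 k + a2 k = 1 / 2 * (real k ^ 3 + real k ^ 2 - 2 * real k)"
    by (simp add: a1_def a2_def field_simps power2_eq_square power3_eq_cube)
  moreover have "max_degree G = 3 \<and>
       real (card (verts_of_degree G 1)) = real k * (real k - 1) \<and>
       real (card (verts_of_degree G 2)) = real k * (real k - 1) * (real k - 2) / 2 \<and>
       real (card (verts_of_degree G 3)) = real k * (real k - 1)"
    if eq: "real (card (pverts G)) = 2 * a1 k + a2 k"
  proof -
    have "card (pverts G) = 2 * a + b" using eq ra rb by linarith
    note e = count(2)[OF this]
    \<comment> \<open>Positivity of \<open>a\<close> makes degree 3 occur, so the bound 3 on the
      degrees is attained.\<close>
    have "0 < a" using assms(3) by (simp add: a_def)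
    then have "{v \<in> pverts G. d v = 3} \<noteq> {}" using e by (metis card.empty less_irrefl)
    then have "max_degree G = 3"
      unfolding max_degree_def d_def[symmetric]
      using e pair_finite_verts by (intro Max_eqI) auto
    then show ?thesis
      using e ra rb by (simp add: verts_of_degree_def d_def a1_def a2_def)
  qed
  ultimately show ?thesis by blast
qed

end
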